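(* Let $n\ge 2$ be an integer and let $(X,\sigma)$ be a subshift with $h_{\mathrm{top}}(\sigma)=0$. Then the Baumslag-Solitar group $\mathrm{BS}(1,n)=\langle a,b \mid bab^{-1}=a^n\rangle$ does not embed in $\mathrm{Aut}(X)$, i.e. there is no injective group homomorphism $\mathrm{BS}(1,n)\to\mathrm{Aut}(X)$.
   Context: Let $\Sigma$ be a finite alphabet with the discrete topology and give $\Sigma^{\mathbb Z}$ the product topology. The left shift $\sigma\colon\Sigma^{\mathbb Z}\to\Sigma^{\mathbb Z}$ is $(\sigma x)[n]=x[n+1]$. A subshift $(X,\sigma)$ is a closed set $X\subset\Sigma^{\mathbb Z}$ invariant under $\sigma$. $\mathrm{Aut}(X)$ is the group (under composition) of homeomorphisms $\phi\colon X\to X$ with $\phi\circ\sigma=\sigma\circ\phi$. The complexity $P_X(n)$ is the number of words of length $n$ that occur in elements of $X$, and $h_{\mathrm{top}}(\sigma)=\lim_{n\to\infty}\frac{\log P_X(n)}{n}$. *)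

theory Defs
  imports "HOL-Analysis.Analysis" "HOL-Algebra.Bij"
begin

section \<open>Subshifts\<close>

definition full_shift :: "'a set \<Rightarrow> (int \<Rightarrow> 'a) topology" where
  "full_shift \<Sigma> = product_topology (\<lambda>_. discrete_topology \<Sigma>) UNIV"

definition shift :: "(int \<Rightarrow> 'a) \<Rightarrow> (int \<Rightarrow> 'a)" where
  "shift x = (\<lambda>n. x (n + 1))"

definition subshift :: "'a set \<Rightarrow> (int \<Rightarrow> 'a) set \<Rightarrow> bool" where
  "subshift \<Sigma> X \<longleftrightarrow> closedin (full_shift \<Sigma>) X \<and> shift ` X = X"

definition words :: "(int \<Rightarrow> 'a) set \<Rightarrow> nat \<Rightarrow> 'a list set" where
  "words X n = {map (\<lambda>j. x (i + int j)) [0..<n] | x i. x \<in> X}"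

definition complexity :: "(int \<Rightarrow> 'a) set \<Rightarrow> nat \<Rightarrow> nat" where
  "complexity X n = card (words X n)"

definition topological_entropy :: "(int \<Rightarrow> 'a) set \<Rightarrow> real" where
  "topological_entropy X = lim (\<lambda>n. ln (real (complexity X n)) / real n)"

text \<open>Elements of \<^const>\<open>Bij\<close> are functions that are \<^const>\<open>undefined\<close> outside \<open>X\<close>, so
  distinct elements of the carrier are distinct as maps \<open>X \<rightarrow> X\<close>; the product of
  \<^const>\<open>BijGroup\<close> is composition.\<close>

definition Aut_shift :: "'a set \<Rightarrow> (int \<Rightarrow> 'a) set \<Rightarrow> ((int \<Rightarrow> 'a) \<Rightarrow> (int \<Rightarrow> 'a)) monoid" where
  "Aut_shift \<Sigma> X = BijGroup X \<lparr>carrier :=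
     {\<phi> \<in> Bij X.
        homeomorphic_map (subtopology (full_shift \<Sigma>) X) (subtopology (full_shift \<Sigma>) X) \<phi> \<and>
        (\<forall>x\<in>X. \<phi> (shift x) = shift (\<phi> x))}\<rparr>"

lemma group_Aut_shift:
  assumes "subshift \<Sigma> X"
  shows "group (Aut_shift \<Sigma> X)"
proof -
  let ?T = "subtopology (full_shift \<Sigma>) X"
  let ?H = "{\<phi> \<in> Bij X. homeomorphic_map ?T ?T \<phi> \<and> (\<forall>x\<in>X. \<phi> (shift x) = shift (\<phi> x))}"
  have sX: "shift x \<in> X" if "x \<in> X" for x
    using assms that by (auto simp: subshift_def)
  have X: "topspace ?T = X"
    using assms closedin_subset by (fastforce simp: subshift_def)
  have "subgroup ?H (BijGroup X)"
  proof (rule group.subgroupI[OF group_BijGroup])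
    show "?H \<subseteq> carrier (BijGroup X)"
      by (auto simp: BijGroup_def)
    have "homeomorphic_map ?T ?T (\<lambda>x\<in>X. x)"
      by (rule homeomorphic_map_eq[of _ _ id]) (auto simp: X)
    then have "(\<lambda>x\<in>X. x) \<in> ?H"
      using id_Bij sX by auto
    then show "?H \<noteq> {}" by blast
  next
    fix f assume f: "f \<in> ?H"
    then have B: "f \<in> Bij X" and hf: "homeomorphic_map ?T ?T f" by auto
    have bij: "bij_betw f X X" using B by (auto simp: Bij_def)
    let ?g = "\<lambda>x\<in>X. inv_into X f x"
    obtain g where g: "homeomorphic_maps ?T ?T f g"
      using hf homeomorphic_map_maps by blast
    have gX: "homeomorphic_map ?T ?T g"
      using g homeomorphic_maps_map by blast
    have gi: "g x = ?g x" if "x \<in> X" for x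
    proof -
      have "g x \<in> X" "f (g x) = x"
        using g that X continuous_map_image_subset_topspace[of ?T ?T g]
        unfolding homeomorphic_maps_def by blast+
      then show ?thesis
        using inv_into_f_f[OF bij_betw_imp_inj_on[OF bij], of "g x"] that by simp
    qed
    have "homeomorphic_map ?T ?T ?g"
      by (rule homeomorphic_map_eq[OF gX]) (use gi X in auto)
    moreover have "?g (shift x) = shift (?g x)" if "x \<in> X" for x
    proof -
      have y: "inv_into X f x \<in> X" "f (inv_into X f x) = x"
        using bij that by (auto simp: bij_betw_def inv_into_into f_inv_into_f)
      then have "f (shift (inv_into X f x)) = shift x"
        using f by auto
      then have "inv_into X f (shift x) = shift (inv_into X f x)"
        using inv_into_f_f[OF bij_betw_imp_inj_on[OF bij] sX[OF y(1)]] by simp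
      then show ?thesis using that sX by simp
    qed
    ultimately show "inv\<^bsub>BijGroup X\<^esub> f \<in> ?H"
      using B by (simp add: inv_BijGroup restrict_inv_into_Bij)
  next
    fix f g assume f: "f \<in> ?H" and g: "g \<in> ?H"
    have gX: "g x \<in> X" if "x \<in> X" for x
      using g that by (auto simp: Bij_def bij_betw_def)
    have "homeomorphic_map ?T ?T (compose X f g)"
      by (rule homeomorphic_map_eq[OF homeomorphic_map_compose[of ?T ?T g ?T f]])
        (use f g X in \<open>auto simp: compose_def\<close>)
    then show "f \<otimes>\<^bsub>BijGroup X\<^esub> g \<in> ?H"
      using f g sX gX by (auto simp: BijGroup_def compose_Bij compose_eq)
  qed
  from subgroup.subgroup_is_group[OF this group_BijGroup] show ?thesis
    by (simp add: Aut_shift_def)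
qed

section \<open>Groups given by generators and relations\<close>

text \<open>A word is a list of letters; the letter \<open>(g, True)\<close> is the generator \<open>g\<close> and
  \<open>(g, False)\<close> is its formal inverse. The group presented by relations \<open>u = v\<close>,
  \<open>(u, v) \<in> R\<close>, is the set of words modulo the least congruence that contains \<open>R\<close> and
  identifies \<open>g g\<inverse>\<close> and \<open>g\<inverse> g\<close> with the empty word.\<close>

type_synonym 'g word = "('g \<times> bool) list"

inductive pres_eq :: "('g word \<times> 'g word) set \<Rightarrow> 'g word \<Rightarrow> 'g word \<Rightarrow> bool"
  for R where
  rel: "(u, v) \<in> R \<Longrightarrow> pres_eq R u v"
| cancel: "pres_eq R [(g, e), (g, \<not> e)] []"
| refl: "pres_eq R u u"
| sym: "pres_eq R u v \<Longrightarrow> pres_eq R v u"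
| trans: "pres_eq R u v \<Longrightarrow> pres_eq R v w \<Longrightarrow> pres_eq R u w"
| append: "pres_eq R u u' \<Longrightarrow> pres_eq R v v' \<Longrightarrow> pres_eq R (u @ v) (u' @ v')"

definition pres_class :: "('g word \<times> 'g word) set \<Rightarrow> 'g word \<Rightarrow> 'g word set" where
  "pres_class R u = {v. pres_eq R u v}"

definition presented_group :: "('g word \<times> 'g word) set \<Rightarrow> 'g word set monoid" where
  "presented_group R =
     \<lparr>carrier = range (pres_class R),
      mult = (\<lambda>C D. \<Union>u\<in>C. \<Union>v\<in>D. pres_class R (u @ v)),
      one = pres_class R []\<rparr>"

lemma pres_class_eq_iff: "pres_class R u = pres_class R v \<longleftrightarrow> pres_eq R u v"
  unfolding pres_class_def by (blast intro: pres_eq.refl pres_eq.sym pres_eq.trans)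

lemma presented_group_mult:
  "pres_class R u \<otimes>\<^bsub>presented_group R\<^esub> pres_class R v = pres_class R (u @ v)"
proof -
  have "pres_class R (u' @ v') = pres_class R (u @ v)"
    if "u' \<in> pres_class R u" "v' \<in> pres_class R v" for u' v'
  proof -
    have "pres_eq R u u'" "pres_eq R v v'"
      using that by (simp_all add: pres_class_def)
    then have "pres_eq R (u' @ v') (u @ v)"
      by (rule pres_eq.sym[OF pres_eq.append])
    then show ?thesis by (simp only: pres_class_eq_iff)
  qed
  moreover have "u \<in> pres_class R u" "v \<in> pres_class R v"
    by (simp_all add: pres_class_def pres_eq.refl)
  ultimately have "(\<Union>u'\<in>pres_class R u. \<Union>v'\<in>pres_class R v. pres_class R (u' @ v')) =
      pres_class R (u @ v)"
    by blast
  then show ?thesis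
    by (simp add: presented_group_def)
qed

lemma pres_eq_inverse: "pres_eq R (rev (map (\<lambda>(g, e). (g, \<not> e)) w) @ w) []"
proof (induction w)
  case Nil
  show ?case by (simp add: pres_eq.refl)
next
  case (Cons l w)
  obtain g e where l: "l = (g, e)" by (cases l)
  let ?v = "rev (map (\<lambda>(g, e). (g, \<not> e)) w)"
  have "pres_eq R [(g, \<not> e), (g, e)] []"
    using pres_eq.cancel[of R g "\<not> e"] by simp
  then have "pres_eq R (?v @ ([(g, \<not> e), (g, e)] @ w)) (?v @ ([] @ w))"
    by (intro pres_eq.append pres_eq.refl)
  then show ?case
    using Cons.IH by (auto simp: l intro: pres_eq.trans)
qed

lemma group_presented_group: "group (presented_group R)"
proof (rule groupI)
  show "\<one>\<^bsub>presented_group R\<^esub> \<in> carrier (presented_group R)"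
    by (simp add: presented_group_def)
next
  fix x y assume "x \<in> carrier (presented_group R)" "y \<in> carrier (presented_group R)"
  then obtain u v where "x = pres_class R u" "y = pres_class R v"
    by (auto simp: presented_group_def)
  then have "x \<otimes>\<^bsub>presented_group R\<^esub> y = pres_class R (u @ v)"
    by (simp only: presented_group_mult)
  then show "x \<otimes>\<^bsub>presented_group R\<^esub> y \<in> carrier (presented_group R)"
    by (simp add: presented_group_def)
next
  fix x y z
  assume "x \<in> carrier (presented_group R)" "y \<in> carrier (presented_group R)"
    "z \<in> carrier (presented_group R)"
  then obtain u v w where "x = pres_class R u" "y = pres_class R v" "z = pres_class R w"
    by (auto simp: presented_group_def)
  then show "x \<otimes>\<^bsub>presented_group R\<^esub> y \<otimes>\<^bsub>presented_group R\<^esub> z =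
      x \<otimes>\<^bsub>presented_group R\<^esub> (y \<otimes>\<^bsub>presented_group R\<^esub> z)"
    by (simp add: presented_group_mult)
next
  fix x assume "x \<in> carrier (presented_group R)"
  then obtain u where x: "x = pres_class R u"
    by (auto simp: presented_group_def)
  have one: "\<one>\<^bsub>presented_group R\<^esub> = pres_class R []"
    by (simp add: presented_group_def)
  show "\<one>\<^bsub>presented_group R\<^esub> \<otimes>\<^bsub>presented_group R\<^esub> x = x"
    by (simp add: x one presented_group_mult)
  have "pres_class R (rev (map (\<lambda>(g, e). (g, \<not> e)) u)) \<otimes>\<^bsub>presented_group R\<^esub> x =
      \<one>\<^bsub>presented_group R\<^esub>"
    unfolding x one presented_group_mult by (simp add: pres_class_eq_iff pres_eq_inverse)
  moreover have "pres_class R (rev (map (\<lambda>(g, e). (g, \<not> e)) u)) \<in> carrier (presented_group R)"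
    by (simp add: presented_group_def)
  ultimately show "\<exists>y\<in>carrier (presented_group R). y \<otimes>\<^bsub>presented_group R\<^esub> x = \<one>\<^bsub>presented_group R\<^esub>"
    by blast
qed

datatype bs_gen = Gen_a | Gen_b

definition BS :: "nat \<Rightarrow> nat \<Rightarrow> bs_gen word set monoid" where
  "BS m n = presented_group
     {([(Gen_b, True)] @ replicate m (Gen_a, True) @ [(Gen_b, False)],
       replicate n (Gen_a, True))}"

end

(* In BS(1,n) one has a^(nq+d) = b a^q b^-1 a^d, so a^i has word length O(log i), and hence the
   image phi of a in Aut(X) satisfies range(phi^i) = O(log i). The columns (phi^i(x)[0]), i < n^K,
   are therefore determined by a word of x of length O(K), and zero entropy leaves at most
   2^K <= n^K of them for some K. By the Morse-Hedlund argument phi has finite order. But a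
   has infinite order, as it acts by x + 1 when b acts by nx on the real line. *)

theory Submission
  imports Defs
begin

section \<open>Fekete's subadditivity lemma\<close>

lemma subadditive_mult_add_le:
  fixes u :: "nat \<Rightarrow> real"
  assumes "\<And>m n. u (m + n) \<le> u m + u n"
  shows "u (q * m + r) \<le> real q * u m + u r"
proof (induction q)
  case (Suc q)
  have "u (Suc q * m + r) \<le> u m + u (q * m + r)"
    using assms[of m "q * m + r"] by (simp add: add.assoc)
  then show ?case using Suc by (simp add: algebra_simps)
qed simp

text \<open>The limit is the infimum \<open>L\<close> of the quotients: if \<open>m\<close> nearly
  attains it, dividing \<open>k\<close> by \<open>m\<close> with remainder bounds
  \<open>u k / k\<close> by \<open>u m / m\<close> plus a term of order 1/k.\<close>

lemma subadditive_convergent: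
  fixes u :: "nat \<Rightarrow> real"
  assumes sub: "\<And>m n. u (m + n) \<le> u m + u n" and nonneg: "\<And>n. 0 \<le> u n"
  shows "convergent (\<lambda>n. u n / real n)"
proof -
  define L where "L = Inf ((\<lambda>n. u n / real n) ` {1..})"
  have bdd: "bdd_below ((\<lambda>n. u n / real n) ` {1..})"
    by (rule bdd_belowI[of _ 0]) (use nonneg in auto)
  have L: "L \<le> u n / real n" if "n \<ge> 1" for n
    unfolding L_def by (rule cInf_lower[OF _ bdd]) (use that in auto)
  have "(\<lambda>n. u n / real n) \<longlonglongrightarrow> L"
  proof (rule LIMSEQ_I)
    fix e :: real assume e: "e > 0"
    have "\<exists>z\<in>(\<lambda>n. u n / real n) ` {1..}. z < L + e / 2"
      unfolding L_def by (rule cInf_lessD) (use e in auto)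
    then obtain m where m: "m \<ge> 1" "u m / real m < L + e / 2" by auto
    \<comment> \<open>A sum in place of a maximum: as \<open>u\<close> is nonnegative, it dominates
      every remainder term.\<close>
    define M where "M = (\<Sum>r<m. u r)"
    have M: "u r \<le> M" if "r < m" for r
      unfolding M_def using that nonneg by (intro member_le_sum) auto
    obtain N :: nat where N: "real N > 2 * M / e" using reals_Archimedean2 by blast
    show "\<exists>no. \<forall>k\<ge>no. norm (u k / real k - L) < e"
    proof (intro exI allI impI)
      fix k assume k: "k \<ge> max 1 N"
      have kpos: "real k > 0" using k by simp
      have "u k \<le> real (k div m) * u m + u (k mod m)"
        using subadditive_mult_add_le[of u "k div m" m "k mod m"] sub by simp
      also have "real (k div m) * u m = real (k div m) * real m * (u m / real m)"
        using m by simp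
      also have "\<dots> \<le> real k * (u m / real m)"
      proof (rule mult_right_mono)
        show "real (k div m) * real m \<le> real k"
          by (metis of_nat_le_iff of_nat_mult div_times_less_eq_dividend)
      qed (use nonneg in simp)
      also have "u (k mod m) \<le> M" using M m by simp
      finally have uk: "u k \<le> real k * (u m / real m) + M" by simp
      have "2 * M / e < real k" using N k by linarith
      then have "M < e / 2 * real k" using e by (simp add: field_simps)
      then have "u k < real k * (u m / real m) + e / 2 * real k" using uk by simp
      also have "\<dots> = (u m / real m + e / 2) * real k" by (simp add: algebra_simps)
      finally have "u k / real k < u m / real m + e / 2"
        using kpos by (simp add: pos_divide_less_eq)
      then show "norm (u k / real k - L) < e" using m L[of k] k by simp
    qed
  qed
  then show ?thesis by (auto simp: convergent_def)
qed

section \<open>Complexity of subshifts\<close>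

lemma subshift_letter:
  assumes "subshift \<Sigma> X" "x \<in> X"
  shows "x i \<in> \<Sigma>"
proof -
  have "X \<subseteq> topspace (full_shift \<Sigma>)"
    using assms(1) by (simp add: subshift_def closedin_subset)
  then show ?thesis using assms(2) by (auto simp: full_shift_def)
qed

lemma finite_words:
  assumes "finite \<Sigma>" "subshift \<Sigma> X"
  shows "finite (words X n)"
proof (rule finite_subset)
  show "words X n \<subseteq> {w. set w \<subseteq> \<Sigma> \<and> length w = n}"
    using subshift_letter[OF assms(2)] by (auto simp: words_def)
  show "finite {w. set w \<subseteq> \<Sigma> \<and> length w = n}"
    using assms(1) by (rule finite_lists_length_eq)
qed

lemma words_add_subset: "words X (m + n) \<subseteq> (\<lambda>(u, v). u @ v) ` (words X m \<times> words X n)"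
proof
  fix w assume "w \<in> words X (m + n)"
  then obtain x i where x: "x \<in> X" and w: "w = map (\<lambda>j. x (i + int j)) [0..<m + n]"
    by (auto simp: words_def)
  let ?u = "map (\<lambda>j. x (i + int j)) [0..<m]"
  let ?v = "map (\<lambda>j. x ((i + int m) + int j)) [0..<n]"
  have "w = ?u @ ?v"
    unfolding w by (rule nth_equalityI) (auto simp: nth_append algebra_simps)
  moreover have "?u \<in> words X m" "?v \<in> words X n"
    using x unfolding words_def by blast+
  ultimately show "w \<in> (\<lambda>(u, v). u @ v) ` (words X m \<times> words X n)" by force
qed

text \<open>Taking logarithms turns this into the subadditivity that Fekete's lemma asks
  for.\<close>

lemma complexity_add_le:
  assumes "finite \<Sigma>" "subshift \<Sigma> X"
  shows "complexity X (m + n) \<le> complexity X m * complexity X n"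
proof -
  have fin: "finite (words X m \<times> words X n)" using finite_words[OF assms] by simp
  have "card (words X (m + n)) \<le> card ((\<lambda>(u, v). u @ v) ` (words X m \<times> words X n))"
    using fin words_add_subset by (intro card_mono finite_imageI)
  also have "\<dots> \<le> card (words X m \<times> words X n)" using fin by (rule card_image_le)
  finally show ?thesis by (simp add: complexity_def card_cartesian_product)
qed

lemma complexity_pos:
  assumes "finite \<Sigma>" "subshift \<Sigma> X" "X \<noteq> {}"
  shows "complexity X n > 0"
  using finite_words[OF assms(1,2), of n] assms(3)
  by (auto simp: complexity_def card_gt_0_iff words_def)

text \<open>Convergence has to be established first: \<^const>\<open>lim\<close> is unspecified on divergent
  sequences.\<close>

lemma topological_entropy_LIMSEQ:
  assumes "finite \<Sigma>" "subshift \<Sigma> X" "X \<noteq> {}"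
  shows "(\<lambda>n. ln (real (complexity X n)) / real n) \<longlonglongrightarrow> topological_entropy X"
  unfolding topological_entropy_def convergent_LIMSEQ_iff[symmetric]
proof (rule subadditive_convergent)
  fix m n
  have pos: "complexity X k > 0" for k using complexity_pos[OF assms] .
  have "real (complexity X (m + n)) \<le> real (complexity X m) * real (complexity X n)"
    using complexity_add_le[OF assms(1,2), of m n] by (metis of_nat_le_iff of_nat_mult)
  then have "ln (real (complexity X (m + n))) \<le> ln (real (complexity X m) * real (complexity X n))"
    using pos by simp
  then show "ln (real (complexity X (m + n))) \<le> ln (real (complexity X m)) + ln (real (complexity X n))"
    using pos by (simp add: ln_mult)
  show "0 \<le> ln (real (complexity X n))" using pos[of n] by simp
qed

section \<open>Range of a block code\<close>

text \<open>No local rule is named, only the dependence on a window of radius \<open>r\<close>.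
  Quantifying over all \<open>k\<close> lets radii add under composition without appeal to
  commutation with the shift.\<close>

definition coding_range :: "(int \<Rightarrow> 'a) set \<Rightarrow> ((int \<Rightarrow> 'a) \<Rightarrow> (int \<Rightarrow> 'a)) \<Rightarrow> nat \<Rightarrow> bool" where
  "coding_range X \<phi> r \<longleftrightarrow> (\<forall>x\<in>X. \<forall>y\<in>X. \<forall>k.
     (\<forall>i. \<bar>i - k\<bar> \<le> int r \<longrightarrow> x i = y i) \<longrightarrow> \<phi> x k = \<phi> y k)"

lemma coding_rangeD:
  assumes "coding_range X \<phi> r" "x \<in> X" "y \<in> X" "\<And>i. \<bar>i - k\<bar> \<le> int r \<Longrightarrow> x i = y i"
  shows "\<phi> x k = \<phi> y k"
  using assms unfolding coding_range_def by blast

lemma coding_range_mono: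
  assumes "coding_range X \<phi> r" "r \<le> s"
  shows "coding_range X \<phi> s"
  unfolding coding_range_def
proof (intro ballI allI impI)
  fix x y k assume xy: "x \<in> X" "y \<in> X" and "\<forall>i. \<bar>i - k\<bar> \<le> int s \<longrightarrow> x i = y i"
  then show "\<phi> x k = \<phi> y k"
    using assms(2) by (intro coding_rangeD[OF assms(1)]) auto
qed

lemma coding_range_compose:
  assumes "coding_range X \<phi> r" "coding_range X \<psi> s" "\<psi> ` X \<subseteq> X"
  shows "coding_range X (compose X \<phi> \<psi>) (r + s)"
  unfolding coding_range_def
proof (intro ballI allI impI)
  fix x y k assume xy: "x \<in> X" "y \<in> X" and eq: "\<forall>i. \<bar>i - k\<bar> \<le> int (r + s) \<longrightarrow> x i = y i"
  have "\<psi> x i = \<psi> y i" if "\<bar>i - k\<bar> \<le> int r" for i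
    by (rule coding_rangeD[OF assms(2) xy]) (use that eq in auto)
  then have "\<phi> (\<psi> x) k = \<phi> (\<psi> y) k"
    using xy assms(3) by (intro coding_rangeD[OF assms(1)]) auto
  then show "compose X \<phi> \<psi> x k = compose X \<phi> \<psi> y k"
    using xy by (simp add: compose_eq)
qed

text \<open>Forward steps follow from commutation. A backward step takes a preimage in
  \<open>X\<close>, which exists since \<open>shift\<close> maps \<open>X\<close> onto
  \<open>X\<close> and is the expected translate since \<open>shift\<close> is injective.\<close>

lemma shift_commuting_translate:
  fixes \<phi> :: "(int \<Rightarrow> 'a) \<Rightarrow> (int \<Rightarrow> 'a)"
  assumes X: "shift ` X = X" and comm: "\<And>x. x \<in> X \<Longrightarrow> \<phi> (shift x) = shift (\<phi> x)"
    and x: "x \<in> X"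
  shows "(\<lambda>i. x (i + k)) \<in> X \<and> \<phi> (\<lambda>i. x (i + k)) = (\<lambda>i. \<phi> x (i + k))"
proof (induction k rule: int_induct[where k = 0])
  case base
  show ?case using x by simp
next
  case (step1 k)
  have "(\<lambda>i. x (i + (k + 1))) = shift (\<lambda>i. x (i + k))"
    "(\<lambda>i. \<phi> x (i + (k + 1))) = shift (\<lambda>i. \<phi> x (i + k))"
    by (auto simp: shift_def algebra_simps)
  then show ?case using step1 comm X by auto
next
  case (step2 k)
  let ?x = "\<lambda>i. x (i + k)"
  obtain y where y: "y \<in> X" "?x = shift y" using step2 X by blast
  have inj: "z = (\<lambda>i. w (i + (k - 1)))" if "(\<lambda>i. w (i + k)) = shift z" for w z :: "int \<Rightarrow> 'a"
  proof
    fix i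
    have "w ((i - 1) + k) = shift z (i - 1)" using fun_cong[OF that] .
    then show "z i = w (i + (k - 1))" by (simp add: shift_def algebra_simps)
  qed
  have "y = (\<lambda>i. x (i + (k - 1)))" using inj y(2) by blast
  moreover have "(\<lambda>i. \<phi> x (i + k)) = shift (\<phi> y)"
    using step2 y comm by auto
  then have "\<phi> y = (\<lambda>i. \<phi> x (i + (k - 1)))" using inj by blast
  ultimately show ?case using y by simp
qed

section \<open>Cylinder sets and the Curtis-Hedlund-Lyndon theorem\<close>

lemma openin_coordinate_fiber:
  assumes "subshift \<Sigma> X"
  shows "openin (subtopology (full_shift \<Sigma>) X) {x \<in> X. x i = c}"
\<comment> \<open>The singleton of \<open>c\<close> is open in the discrete space only for
  \<open>c\<close> in the alphabet; otherwise the fiber is empty.\<close>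
proof (cases "c \<in> \<Sigma>")
  case True
  let ?T = "subtopology (full_shift \<Sigma>) X"
  have "continuous_map ?T (discrete_topology \<Sigma>) (\<lambda>x. x i)"
    unfolding full_shift_def
    by (rule continuous_map_from_subtopology) (rule continuous_map_product_projection, simp)
  then have "openin ?T {x \<in> topspace ?T. x i \<in> {c}}"
    using True by (intro openin_continuous_map_preimage) auto
  moreover have "topspace ?T = X"
    using assms closedin_subset by (fastforce simp: subshift_def)
  ultimately show ?thesis by (simp only: singleton_iff)
next
  case False
  then have "{x \<in> X. x i = c} = {}" using subshift_letter[OF assms] by blast
  then show ?thesis by (simp only: openin_empty)
qed

lemma openin_cylinder:
  assumes "subshift \<Sigma> X" "x \<in> X"
  shows "openin (subtopology (full_shift \<Sigma>) X) {y \<in> X. \<forall>i. \<bar>i\<bar> \<le> int r \<longrightarrow> y i = x i}"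
proof -
  have "openin (subtopology (full_shift \<Sigma>) X) (\<Inter>i\<in>{-int r..int r}. {y \<in> X. y i = x i})"
    by (rule openin_INT2) (use openin_coordinate_fiber[OF assms(1)] in auto)
  moreover have "(\<Inter>i\<in>{-int r..int r}. {y \<in> X. y i = x i}) =
      {y \<in> X. \<forall>i. \<bar>i\<bar> \<le> int r \<longrightarrow> y i = x i}"
    by (auto simp: abs_le_iff)
  ultimately show ?thesis by simp
qed

lemma openin_contains_cylinder:
  assumes S: "subshift \<Sigma> X" and U: "openin (subtopology (full_shift \<Sigma>) X) U" and x: "x \<in> U"
  shows "\<exists>r. {y \<in> X. \<forall>i. \<bar>i\<bar> \<le> int r \<longrightarrow> y i = x i} \<subseteq> U"
proof -
  obtain V where V: "openin (full_shift \<Sigma>) V" "U = V \<inter> X"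
    using U by (auto simp: openin_subtopology)
  then obtain B where B: "finite {i. B i \<noteq> \<Sigma>}" "x \<in> Pi\<^sub>E UNIV B" "Pi\<^sub>E UNIV B \<subseteq> V"
    using x unfolding full_shift_def openin_product_topology_alt by auto
  \<comment> \<open>A basic open set constrains finitely many coordinates; the sum of their absolute
    values bounds each of them.\<close>
  define r where "r = (\<Sum>i\<in>{i. B i \<noteq> \<Sigma>}. nat \<bar>i\<bar>)"
  have r: "\<bar>i\<bar> \<le> int r" if "B i \<noteq> \<Sigma>" for i
  proof -
    have "nat \<bar>i\<bar> \<le> r"
      unfolding r_def using that B(1) by (intro member_le_sum[where f = "\<lambda>i. nat \<bar>i\<bar>"]) auto
    then show ?thesis by linarith
  qed
  have "y \<in> U" if y: "y \<in> X" "\<forall>i. \<bar>i\<bar> \<le> int r \<longrightarrow> y i = x i" for y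
  proof -
    have "y i \<in> B i" for i
      using r[of i] y B(2) subshift_letter[OF S y(1), of i] by (cases "B i = \<Sigma>") auto
    then show ?thesis using B(3) V(2) y(1) by auto
  qed
  then show ?thesis by blast
qed

text \<open>By continuity, coordinate 0 of the image is constant on a cylinder around each point.
  Compactness leaves finitely many cylinders, hence one radius, and commutation with the shift
  carries the bound from coordinate 0 to all others.\<close>

lemma Curtis_Hedlund_Lyndon:
  assumes fin: "finite \<Sigma>" and S: "subshift \<Sigma> X"
    and cont: "continuous_map (subtopology (full_shift \<Sigma>) X) (subtopology (full_shift \<Sigma>) X) \<phi>"
    and comm: "\<And>x. x \<in> X \<Longrightarrow> \<phi> (shift x) = shift (\<phi> x)"
  shows "\<exists>r. coding_range X \<phi> r"
proof -
  let ?T = "subtopology (full_shift \<Sigma>) X"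
  let ?C = "\<lambda>x r. {y \<in> X. \<forall>i. \<bar>i\<bar> \<le> int r \<longrightarrow> y i = x i}"
  have clX: "closedin (full_shift \<Sigma>) X" and sX: "shift ` X = X"
    using S by (auto simp: subshift_def)
  have top: "topspace ?T = X" using clX closedin_subset by fastforce
  have "compact_space (full_shift \<Sigma>)"
    unfolding full_shift_def compact_space_product_topology
    using fin by (simp add: compact_space_discrete_topology)
  then have "compact_space ?T"
    using clX closedin_compact_space compact_space_subtopology by blast
  have "\<exists>r. \<forall>y\<in>?C x r. \<phi> y 0 = \<phi> x 0" if x: "x \<in> X" for x
  proof -
    have img: "\<phi> y \<in> X" if "y \<in> X" for y
      using continuous_map_image_subset_topspace[OF cont] that top by auto
    have "openin ?T {y \<in> topspace ?T. \<phi> y \<in> {z \<in> X. z 0 = \<phi> x 0}}"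
      by (rule openin_continuous_map_preimage[OF cont openin_coordinate_fiber[OF S]])
    moreover have "{y \<in> topspace ?T. \<phi> y \<in> {z \<in> X. z 0 = \<phi> x 0}} = {y \<in> X. \<phi> y 0 = \<phi> x 0}"
      unfolding top using img by blast
    ultimately have U: "openin ?T {y \<in> X. \<phi> y 0 = \<phi> x 0}" by (simp only:)
    have "x \<in> {y \<in> X. \<phi> y 0 = \<phi> x 0}" using x by simp
    from openin_contains_cylinder[OF S U this] show ?thesis by fast
  qed
  then have "\<forall>x\<in>X. \<exists>r. \<forall>y\<in>?C x r. \<phi> y 0 = \<phi> x 0" by (rule ballI)
  from bchoice[OF this] obtain \<rho> where
    \<rho>': "\<forall>x\<in>X. \<forall>y\<in>?C x (\<rho> x). \<phi> y 0 = \<phi> x 0" ..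
  have \<rho>: "\<phi> y 0 = \<phi> x 0" if "x \<in> X" "y \<in> ?C x (\<rho> x)" for x y
    using \<rho>'[rule_format, OF that] .
  let ?\<U> = "(\<lambda>x. ?C x (\<rho> x)) ` X"
  have "\<forall>U\<in>?\<U>. openin ?T U" using openin_cylinder[OF S] by blast
  moreover have "topspace ?T \<subseteq> \<Union>?\<U>" using top by blast
  ultimately have cover: "\<exists>\<F>. finite \<F> \<and> \<F> \<subseteq> ?\<U> \<and> topspace ?T \<subseteq> \<Union>\<F>"
    using \<open>compact_space ?T\<close> unfolding compact_space_alt by presburger
  obtain F where F: "finite F" "F \<subseteq> X" "X \<subseteq> (\<Union>x\<in>F. ?C x (\<rho> x))"
  proof -
    from cover obtain \<F> where \<F>: "finite \<F>" "\<F> \<subseteq> ?\<U>" "topspace ?T \<subseteq> \<Union>\<F>" by blast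
    obtain F where "F \<subseteq> X" "finite F" "\<F> = (\<lambda>x. ?C x (\<rho> x)) ` F"
      using finite_subset_image[OF \<F>(1,2)] by blast
    then show thesis using that \<F>(3) top by blast
  qed
  define r where "r = (\<Sum>x\<in>F. \<rho> x)"
  have r: "\<rho> x \<le> r" if "x \<in> F" for x
    unfolding r_def using that F(1) by (intro member_le_sum) auto
  have zero: "\<phi> y 0 = \<phi> z 0" if yz: "y \<in> X" "z \<in> X" "\<And>i. \<bar>i\<bar> \<le> int r \<Longrightarrow> y i = z i" for y z
  proof -
    obtain x where x: "x \<in> F" "y \<in> ?C x (\<rho> x)" using F(3) yz(1) by blast
    \<comment> \<open>The radius of the cylinder containing \<open>y\<close> is at most
      \<open>r\<close>, so \<open>z\<close> lies in it too, and both images agree at 0 with that of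
      the centre \<open>x\<close>.\<close>
    have "z i = x i" if "\<bar>i\<bar> \<le> int (\<rho> x)" for i
    proof -
      have "\<bar>i\<bar> \<le> int r" using that r[OF x(1)] by linarith
      then show ?thesis using x(2) yz(3)[of i] that by auto
    qed
    then have z: "z \<in> ?C x (\<rho> x)" using yz(2) by blast
    have "x \<in> X" using x(1) F(2) by (rule subsetD[rotated])
    from \<rho>[OF this x(2)] \<rho>[OF this z] show ?thesis by simp
  qed
  have "coding_range X \<phi> r"
    unfolding coding_range_def
  proof (intro ballI allI impI)
    fix x y k assume xy: "x \<in> X" "y \<in> X" and eq: "\<forall>i. \<bar>i - k\<bar> \<le> int r \<longrightarrow> x i = y i"
    note tx = shift_commuting_translate[of X \<phi> x k, OF sX comm xy(1)]
    note ty = shift_commuting_translate[of X \<phi> y k, OF sX comm xy(2)]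
    have "\<phi> (\<lambda>i. x (i + k)) 0 = \<phi> (\<lambda>i. y (i + k)) 0"
    proof (rule zero[OF conjunct1[OF tx] conjunct1[OF ty]])
      show "x (i + k) = y (i + k)" if "\<bar>i\<bar> \<le> int r" for i
        using eq[rule_format, of "i + k"] that by simp
    qed
    then show "\<phi> x k = \<phi> y k"
      using fun_cong[OF conjunct2[OF tx], of 0] fun_cong[OF conjunct2[OF ty], of 0] by simp
  qed
  then show ?thesis ..
qed

section \<open>Columns of the space-time diagram\<close>

lemma funpow_image_eq:
  assumes "f ` X = X"
  shows "(f ^^ i) ` X = X"
proof (induction i)
  case (Suc i)
  have "(f ^^ Suc i) ` X = f ` (f ^^ i) ` X" by (simp add: image_comp)
  then show ?case using Suc assms by simp
qed simp

lemma surj_factor_finite_order: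
  assumes surj: "\<phi> ` X = X" and fin: "finite (f ` X)"
    and factor: "\<And>x y. x \<in> X \<Longrightarrow> y \<in> X \<Longrightarrow> f x = f y \<Longrightarrow> f (\<phi> x) = f (\<phi> y)"
  shows "\<exists>p>0. \<forall>x\<in>X. f ((\<phi> ^^ p) x) = f x"
proof -
  have mem: "(\<phi> ^^ i) x \<in> X" if "x \<in> X" for i x
    using funpow_image_eq[OF surj, of i] that by blast
  have factor_pow: "f ((\<phi> ^^ i) x) = f ((\<phi> ^^ i) y)"
    if "x \<in> X" "y \<in> X" "f x = f y" for i x y
    by (induction i) (use that factor mem in auto)
  define g where "g i = (\<lambda>w\<in>f ` X. f ((\<phi> ^^ i) (inv_into X f w)))" for i
  have g: "g i (f x) = f ((\<phi> ^^ i) x)" if "x \<in> X" for i x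
  proof -
    have "inv_into X f (f x) \<in> X" "f (inv_into X f (f x)) = f x"
      using that by (auto intro: inv_into_into f_inv_into_f)
    from factor_pow[OF this(1) that this(2)] show ?thesis using that by (simp add: g_def)
  qed
  have "range g \<subseteq> (f ` X) \<rightarrow>\<^sub>E (f ` X)"
    unfolding g_def by (auto intro!: imageI mem inv_into_into)
  then have "finite (range g)"
    by (rule finite_subset) (intro finite_PiE fin)
  then have "\<not> inj g" using finite_imageD by blast
  then obtain i j where ij: "i < j" "g i = g j"
    unfolding inj_on_def by (metis linorder_neqE_nat)
  have "f ((\<phi> ^^ (j - i)) x) = f x" if x: "x \<in> X" for x
  proof -
    obtain y where y: "y \<in> X" "x = (\<phi> ^^ i) y"
      using funpow_image_eq[OF surj, of i] x by blast
    have "(\<phi> ^^ (j - i)) x = (\<phi> ^^ j) y"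
      using ij(1) funpow_add[of "j - i" i \<phi>] by (simp add: y(2))
    then show ?thesis using g[OF y(1), of i] g[OF y(1), of j] ij(2) y(2) by simp
  qed
  then show ?thesis using ij(1) by (intro exI[of _ "j - i"]) auto
qed

definition column :: "((int \<Rightarrow> 'a) \<Rightarrow> (int \<Rightarrow> 'a)) \<Rightarrow> nat \<Rightarrow> (int \<Rightarrow> 'a) \<Rightarrow> 'a list" where
  "column \<phi> N x = map (\<lambda>i. (\<phi> ^^ i) x 0) [0..<N]"

lemma take_column: "j \<le> N \<Longrightarrow> take j (column \<phi> N x) = column \<phi> j x"
  by (simp add: column_def take_map)

text \<open>A column of height j + 1 contains the columns of height j of both \<open>x\<close> and
  \<open>\<phi> x\<close>, so determining its last entry makes \<open>\<phi>\<close> act on columns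
  of height j.\<close>

lemma tl_column: "tl (column \<phi> (Suc j) x) = column \<phi> j (\<phi> x)"
  by (rule nth_equalityI) (auto simp: column_def nth_tl funpow_swap1 simp del: upt_Suc)

text \<open>The argument of Morse and Hedlund: the number of columns of height \<open>j\<close> is
  nondecreasing in \<open>j\<close> and does not grow strictly up to height \<open>N\<close>; when it stays constant
  from \<open>j\<close> to \<open>j + 1\<close>, a column of height \<open>j\<close> determines the next one.\<close>

lemma few_columns_finite_order:
  assumes surj: "\<phi> ` X = X" and sX: "shift ` X = X"
    and comm: "\<And>x. x \<in> X \<Longrightarrow> \<phi> (shift x) = shift (\<phi> x)"
    and fin: "finite (column \<phi> N ` X)" and few: "card (column \<phi> N ` X) \<le> N"
  shows "\<exists>p>0. \<forall>x\<in>X. (\<phi> ^^ p) x = x"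
proof (cases "X = {}")
  case False
  have take_image: "column \<phi> j ` X = take j ` column \<phi> k ` X" if "j \<le> k" for j k
    unfolding image_image by (rule image_cong) (auto simp: take_column that)
  have fin': "finite (column \<phi> j ` X)" if "j \<le> N" for j
    unfolding take_image[OF that] using fin by blast
  have "\<exists>j<N. card (column \<phi> j ` X) = card (column \<phi> (Suc j) ` X)"
  proof (rule ccontr)
    assume "\<not> (\<exists>j<N. card (column \<phi> j ` X) = card (column \<phi> (Suc j) ` X))"
    then have neq: "card (column \<phi> j ` X) \<noteq> card (column \<phi> (Suc j) ` X)" if "j < N" for j
      using that by blast
    \<comment> \<open>At height 0 there is exactly one column, the empty list; strict growth from
      there would exceed \<open>N\<close> at height \<open>N\<close>.\<close>
    have "j < card (column \<phi> j ` X)" if "j \<le> N" for j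
      using that
    proof (induction j)
      case 0
      show ?case using False fin'[of 0] by (simp add: card_gt_0_iff)
    next
      case (Suc j)
      have "card (column \<phi> j ` X) \<le> card (column \<phi> (Suc j) ` X)"
        using take_image[of j "Suc j"] fin'[OF Suc.prems] card_image_le by fastforce
      then show ?case using Suc neq[of j] by simp
    qed
    then show False using few by force
  qed
  then obtain j where j: "j < N" "card (column \<phi> j ` X) = card (column \<phi> (Suc j) ` X)"
    by blast
  \<comment> \<open>Truncation is a surjection between finite sets of equal size.\<close>
  have inj: "inj_on (take j) (column \<phi> (Suc j) ` X)"
    using j fin' take_image[of j "Suc j"] by (intro eq_card_imp_inj_on) auto
  have det: "column \<phi> (Suc j) x = column \<phi> (Suc j) y"
    if "x \<in> X" "y \<in> X" "column \<phi> j x = column \<phi> j y" for x y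
    by (rule inj_onD[OF inj]) (use that in \<open>simp_all add: take_column\<close>)
  have "\<exists>p>0. \<forall>x\<in>X. column \<phi> j ((\<phi> ^^ p) x) = column \<phi> j x"
  proof (rule surj_factor_finite_order[OF surj])
    show "finite (column \<phi> j ` X)" using fin' j(1) by simp
    show "column \<phi> j (\<phi> x) = column \<phi> j (\<phi> y)"
      if "x \<in> X" "y \<in> X" "column \<phi> j x = column \<phi> j y" for x y
      unfolding tl_column[symmetric] using det[OF that] by (rule arg_cong)
  qed
  then obtain p where p: "p > 0" "\<And>x. x \<in> X \<Longrightarrow> column \<phi> j ((\<phi> ^^ p) x) = column \<phi> j x"
    by blast
  have mem: "(\<phi> ^^ i) x \<in> X" if "x \<in> X" for i x
    using funpow_image_eq[OF surj, of i] that by blast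
  have commp: "(\<phi> ^^ i) (shift x) = shift ((\<phi> ^^ i) x)" if "x \<in> X" for i x
    by (induction i) (use that mem comm in auto)
  have zero: "(\<phi> ^^ p) x 0 = x 0" if "x \<in> X" for x
  proof -
    \<comment> \<open>Height j may be 0, where a column does not show coordinate 0; the extension by
      one entry always does.\<close>
    have "column \<phi> (Suc j) ((\<phi> ^^ p) x) = column \<phi> (Suc j) x"
      using det p(2) mem that by blast
    then have "column \<phi> (Suc j) ((\<phi> ^^ p) x) ! 0 = column \<phi> (Suc j) x ! 0" by simp
    then show ?thesis by (simp add: column_def del: upt_Suc)
  qed
  have "(\<phi> ^^ p) x = x" if x: "x \<in> X" for x
  proof
    fix k
    let ?y = "\<lambda>i. x (i + k)"
    have y: "?y \<in> X \<and> (\<phi> ^^ p) ?y = (\<lambda>i. (\<phi> ^^ p) x (i + k))"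
      using sX commp x by (rule shift_commuting_translate[of X "\<phi> ^^ p" x k])
    then have "(\<phi> ^^ p) x (0 + k) = (\<phi> ^^ p) ?y 0" by simp
    also have "\<dots> = x k" using zero[of ?y] y by simp
    finally show "(\<phi> ^^ p) x k = x k" by simp
  qed
  then show ?thesis using p(1) by blast
qed auto

section \<open>Zero entropy and logarithmic range\<close>

lemma card_column_le_complexity:
  assumes fin: "finite \<Sigma>" and S: "subshift \<Sigma> X"
    and R: "\<And>i. i < N \<Longrightarrow> coding_range X (\<phi> ^^ i) R"
  shows "finite (column \<phi> N ` X)" "card (column \<phi> N ` X) \<le> complexity X (2 * R + 1)"
proof -
  let ?w = "\<lambda>x :: int \<Rightarrow> 'a. map (\<lambda>j. x (- int R + int j)) [0..<2 * R + 1]"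
  have eq: "column \<phi> N x = column \<phi> N y" if xy: "x \<in> X" "y \<in> X" "?w x = ?w y" for x y
  proof -
    have "x i = y i" if "\<bar>i - 0\<bar> \<le> int R" for i
    proof -
      have "?w x ! nat (i + int R) = ?w y ! nat (i + int R)" using xy(3) by (rule arg_cong)
      moreover have "nat (i + int R) < 2 * R + 1" using that by linarith
      moreover have "- int R + int (nat (i + int R)) = i" using that by linarith
      ultimately show ?thesis by (simp del: upt_Suc)
    qed
    then have "(\<phi> ^^ i) x 0 = (\<phi> ^^ i) y 0" if "i < N" for i
      by (intro coding_rangeD[OF R[OF that] xy(1,2)]) auto
    then show ?thesis by (simp add: column_def)
  qed
  have sub: "?w ` X \<subseteq> words X (2 * R + 1)" unfolding words_def by blast
  have finw: "finite (?w ` X)" using sub finite_words[OF fin S] finite_subset by blast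
  \<comment> \<open>The column map factors through the central word of length 2R + 1, so there are
    at most as many columns as such words.\<close>
  have img: "column \<phi> N ` X = (\<lambda>w. column \<phi> N (inv_into X ?w w)) ` ?w ` X"
    unfolding image_image
  proof (rule image_cong)
    fix x assume x: "x \<in> X"
    have "inv_into X ?w (?w x) \<in> X" "?w (inv_into X ?w (?w x)) = ?w x"
      using x by (rule inv_into_into[OF imageI], rule f_inv_into_f[OF imageI])
    then show "column \<phi> N x = column \<phi> N (inv_into X ?w (?w x))" using eq x by metis
  qed simp
  show "finite (column \<phi> N ` X)" unfolding img using finw by blast
  have "card (column \<phi> N ` X) \<le> card (?w ` X)"
    unfolding img using finw by (rule card_image_le)
  also have "\<dots> \<le> card (words X (2 * R + 1))"
    using sub finite_words[OF fin S] by (intro card_mono)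
  finally show "card (column \<phi> N ` X) \<le> complexity X (2 * R + 1)"
    by (simp add: complexity_def)
qed

text \<open>Columns of height \<open>n ^ K\<close> are determined by words whose length is linear in
  \<open>K\<close>. Zero entropy makes these fewer than 2^K for a suitable \<open>K\<close>, so the
  Morse-Hedlund argument applies.\<close>

lemma zero_entropy_log_range_finite_order:
  fixes n C :: nat
  assumes fin: "finite \<Sigma>" and S: "subshift \<Sigma> X" and zero: "topological_entropy X = 0"
    and surj: "\<phi> ` X = X" and comm: "\<And>x. x \<in> X \<Longrightarrow> \<phi> (shift x) = shift (\<phi> x)"
    and n: "n \<ge> 2"
    and R: "\<And>K i. i < n ^ K \<Longrightarrow> coding_range X (\<phi> ^^ i) (C * K)"
  shows "\<exists>p>0. \<forall>x\<in>X. (\<phi> ^^ p) x = x"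
proof (cases "X = {}")
  case False
  have sX: "shift ` X = X" using S by (simp add: subshift_def)
  \<comment> \<open>The successor is positive even for \<open>C = 0\<close>, so that
    \<open>e\<close> is a genuine quotient and \<open>m\<close> grows with \<open>K\<close>.\<close>
  let ?C = "Suc C"
  define e where "e = ln 2 / (3 * real ?C)"
  have e: "e > 0" by (auto simp: e_def intro!: divide_pos_pos)
  have "\<forall>\<^sub>F m in sequentially. ln (real (complexity X m)) / real m < e"
    using topological_entropy_LIMSEQ[OF fin S False] e unfolding zero by (rule order_tendstoD)
  then obtain M where M: "\<And>m. m \<ge> M \<Longrightarrow> ln (real (complexity X m)) / real m < e"
    by (auto simp: eventually_sequentially)
  \<comment> \<open>Positive, so that the extra 1 in \<open>m\<close> is absorbed by a third copy of
    \<open>?C * K\<close>; the factor 3 in \<open>e\<close> then makes the bound exactly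
    \<open>K * ln 2\<close>.\<close>
  define K where "K = Suc M"
  define m where "m = 2 * (?C * K) + 1"
  have m: "m \<ge> M" "m \<le> 3 * (?C * K)" by (auto simp: m_def K_def)
  have "ln (real (complexity X m)) < e * real m"
  proof -
    have "real m > 0" unfolding m_def of_nat_0_less_iff by simp
    then show ?thesis using M[OF m(1)] by (simp only: pos_divide_less_eq)
  qed
  also have "\<dots> \<le> e * real (3 * (?C * K))"
    using e m(2) by (intro mult_left_mono) (simp_all only: of_nat_le_iff less_imp_le)
  also have "\<dots> = ln (2 ^ K)"
  proof -
    have "real (3 * (?C * K)) = 3 * real ?C * real K" by (simp only: of_nat_mult of_nat_numeral mult.assoc)
    then show ?thesis by (simp add: e_def ln_realpow del: of_nat_Suc)
  qed
  finally have "real (complexity X m) < 2 ^ K"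
    using complexity_pos[OF fin S False, of m] by simp
  also have "(2::real) ^ K \<le> real n ^ K" using n by (intro power_mono) auto
  finally have few: "complexity X m \<le> n ^ K"
    by (metis less_imp_le of_nat_less_iff of_nat_power)
  have range: "coding_range X (\<phi> ^^ i) (?C * K)" if "i < n ^ K" for i
    using R[OF that] by (rule coding_range_mono) simp
  note columns = card_column_le_complexity[OF fin S range, folded m_def]
  show ?thesis
    by (rule few_columns_finite_order[OF surj sX comm columns(1) order_trans[OF columns(2) few]])
qed auto

section \<open>The Baumslag--Solitar group\<close>

abbreviation BS_rel :: "nat \<Rightarrow> (bs_gen word \<times> bs_gen word) set" where
  "BS_rel n \<equiv> {([(Gen_b, True)] @ replicate 1 (Gen_a, True) @ [(Gen_b, False)],
     replicate n (Gen_a, True))}"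

text \<open>Inserting b^-1 b splits the conjugate of a^(q+1) into the conjugates of a^q and of a,
  and the exponents nq and n add.\<close>

lemma BS_conj_power:
  "pres_eq (BS_rel n) ([(Gen_b, True)] @ replicate q (Gen_a, True) @ [(Gen_b, False)])
     (replicate (n * q) (Gen_a, True))"
proof (induction q)
  case 0
  show ?case using pres_eq.cancel[of _ Gen_b True] by simp
next
  case (Suc q)
  let ?a = "(Gen_a, True)" and ?b = "(Gen_b, True)" and ?B = "(Gen_b, False)"
  have "pres_eq (BS_rel n) [?B, ?b] []"
    using pres_eq.cancel[of _ Gen_b False] by simp
  then have "pres_eq (BS_rel n) ((?b # replicate q ?a) @ [?B, ?b] @ [?a, ?B])
      ((?b # replicate q ?a) @ [] @ [?a, ?B])"
    by (intro pres_eq.append pres_eq.refl)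
  moreover have "(?b # replicate q ?a) @ [?B, ?b] @ [?a, ?B] =
      ([?b] @ replicate q ?a @ [?B]) @ ([?b] @ replicate 1 ?a @ [?B])" by simp
  moreover have "(?b # replicate q ?a) @ [] @ [?a, ?B] = [?b] @ replicate (Suc q) ?a @ [?B]"
    by (simp add: replicate_app_Cons_same)
  ultimately have 1: "pres_eq (BS_rel n) ([?b] @ replicate (Suc q) ?a @ [?B])
      (([?b] @ replicate q ?a @ [?B]) @ ([?b] @ replicate 1 ?a @ [?B]))"
    by (simp only: pres_eq.sym)
  have 2: "pres_eq (BS_rel n) ([?b] @ replicate 1 ?a @ [?B]) (replicate n ?a)"
    by (rule pres_eq.rel) simp
  have 3: "pres_eq (BS_rel n) (([?b] @ replicate q ?a @ [?B]) @ ([?b] @ replicate 1 ?a @ [?B]))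
      (replicate (n * q) ?a @ replicate n ?a)"
    by (rule pres_eq.append[OF Suc.IH 2])
  have "replicate (n * q) ?a @ replicate n ?a = replicate (n * Suc q) ?a"
    by (simp add: replicate_add[symmetric] add.commute)
  then show ?case using pres_eq.trans[OF 1 3] by simp
qed

section \<open>The affine action on the real line\<close>

fun affine_act :: "nat \<Rightarrow> bs_gen \<times> bool \<Rightarrow> real \<Rightarrow> real" where
  "affine_act n (Gen_a, e) x = (if e then x + 1 else x - 1)"
| "affine_act n (Gen_b, e) x = (if e then real n * x else x / real n)"

lemma affine_act_replicate:
  "foldr (affine_act n) (replicate k (Gen_a, True)) x = x + real k"
  by (induction k) auto

text \<open>The defining relation holds because n(x/n + 1) = x + n; positivity of \<open>n\<close>
  makes the two letters of \<open>Gen_b\<close> mutually inverse.\<close>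

lemma pres_eq_affine_act:
  assumes "pres_eq (BS_rel n) u v" "n > 0"
  shows "foldr (affine_act n) u = foldr (affine_act n) v"
  using assms(1)
proof induction
  case (rel u v)
  then have uv: "u = [(Gen_b, True), (Gen_a, True), (Gen_b, False)]"
    "v = replicate n (Gen_a, True)" by auto
  show ?case
    unfolding uv using assms(2)
    by (simp add: fun_eq_iff affine_act_replicate distrib_left del: foldr_replicate)
next
  case (cancel g e)
  show ?case using assms(2) by (cases g) (auto simp: fun_eq_iff)
qed (auto simp: fun_eq_iff)

text \<open>The word a^p moves 0 to p, while the empty word fixes it.\<close>

lemma BS_generator_infinite_order:
  assumes "n > 0" "pres_eq (BS_rel n) (replicate p (Gen_a, True)) []"
  shows "p = 0"
  using pres_eq_affine_act[OF assms(2,1)] affine_act_replicate[of n p 0] by simp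

section \<open>Embeddings into the automorphism group\<close>

lemma Aut_shift_carrierD:
  assumes "subshift \<Sigma> X" "f \<in> carrier (Aut_shift \<Sigma> X)"
  shows "f \<in> Bij X" "f ` X = X"
    "continuous_map (subtopology (full_shift \<Sigma>) X) (subtopology (full_shift \<Sigma>) X) f"
    "\<And>x. x \<in> X \<Longrightarrow> f (shift x) = shift (f x)"
  using assms(2)
  by (auto simp: Aut_shift_def Bij_def bij_betw_def homeomorphic_imp_continuous_map)

lemma Aut_shift_mult:
  assumes "subshift \<Sigma> X" "f \<in> carrier (Aut_shift \<Sigma> X)" "g \<in> carrier (Aut_shift \<Sigma> X)"
  shows "f \<otimes>\<^bsub>Aut_shift \<Sigma> X\<^esub> g = compose X f g"
  using Aut_shift_carrierD(1)[OF assms(1,2)] Aut_shift_carrierD(1)[OF assms(1,3)]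
  by (simp add: Aut_shift_def BijGroup_def)

lemma Aut_shift_one: "\<one>\<^bsub>Aut_shift \<Sigma> X\<^esub> = (\<lambda>x\<in>X. x)"
  by (simp add: Aut_shift_def BijGroup_def)

text \<open>Only values on \<open>X\<close> matter; this serves to pass from automorphisms,
  \<open>undefined\<close> off \<open>X\<close>, to plain iterates.\<close>

lemma coding_range_cong:
  assumes "coding_range X \<phi> r" "\<And>x. x \<in> X \<Longrightarrow> \<phi> x = \<psi> x"
  shows "coding_range X \<psi> r"
  using assms unfolding coding_range_def by metis

theorem mainTheorem2:
  fixes \<Sigma> :: "'a set" and X :: "(int \<Rightarrow> 'a) set" and n :: nat
  assumes "n \<ge> 2"
    and "finite \<Sigma>"
    and "subshift \<Sigma> X"
    and "topological_entropy X = 0"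
  shows "\<not> (\<exists>h \<in> hom (BS 1 n) (Aut_shift \<Sigma> X). inj_on h (carrier (BS 1 n)))"
proof
  assume "\<exists>h \<in> hom (BS 1 n) (Aut_shift \<Sigma> X). inj_on h (carrier (BS 1 n))"
  then obtain h where hom: "h \<in> hom (BS 1 n) (Aut_shift \<Sigma> X)"
    and inj: "inj_on h (carrier (BS 1 n))" by blast
  let ?G = "Aut_shift \<Sigma> X"
  define H where "H w = h (pres_class (BS_rel n) w)" for w
  define \<phi> where "\<phi> = H [(Gen_a, True)]"
  define A where "A i = H (replicate i (Gen_a, True))" for i
  have carr: "pres_class (BS_rel n) w \<in> carrier (BS 1 n)" for w
    by (simp add: BS_def presented_group_def)
  have HG: "H w \<in> carrier ?G" for w
    unfolding H_def using hom carr by (rule hom_in_carrier)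
  note H = Aut_shift_carrierD[OF assms(3) HG]
  have Hsub: "H w ` X \<subseteq> X" for w using H(2) by simp
  have H_append: "H (u @ v) = compose X (H u) (H v)" for u v
  proof -
    have "H (u @ v) = H u \<otimes>\<^bsub>?G\<^esub> H v"
      unfolding H_def using hom_mult[OF hom carr carr, of u v]
      by (simp add: BS_def presented_group_mult)
    then show ?thesis by (simp add: Aut_shift_mult[OF assms(3) HG HG])
  qed
  have H_Nil: "H [] = (\<lambda>x\<in>X. x)"
  proof -
    have "h \<one>\<^bsub>BS 1 n\<^esub> = \<one>\<^bsub>?G\<^esub>"
      by (rule hom_one[OF hom])
        (simp_all add: BS_def group_presented_group group_Aut_shift[OF assms(3)])
    then show ?thesis
      by (simp add: H_def Aut_shift_one BS_def presented_group_def)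
  qed
  have H_eq: "H u = H v" if "pres_eq (BS_rel n) u v" for u v
    unfolding H_def pres_class_eq_iff[THEN iffD2, OF that] ..
  have A_Suc: "A (Suc i) = compose X \<phi> (A i)" for i
    using H_append[of "[(Gen_a, True)]" "replicate i (Gen_a, True)"] by (simp add: A_def \<phi>_def)
  have A_funpow: "A i x = (\<phi> ^^ i) x" if "x \<in> X" for i x
  proof (induction i)
    case 0
    show ?case using that by (simp add: A_def H_Nil)
  next
    case (Suc i)
    then show ?case using that by (simp add: A_Suc compose_eq)
  qed
  have "\<exists>r. coding_range X (H w) r" for w
    by (rule Curtis_Hedlund_Lyndon[OF assms(2,3) H(3,4)])
  then obtain \<rho> where \<rho>: "\<And>w. coding_range X (H w) (\<rho> w)" by metis
  define ra where "ra = \<rho> [(Gen_a, True)]"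
  define rb where "rb = \<rho> [(Gen_b, True)] + \<rho> [(Gen_b, False)]"
  \<comment> \<open>The cost of one base-\<open>n\<close> digit: a conjugation by b and at most
    \<open>n\<close> further factors \<open>\<phi>\<close>.\<close>
  define C where "C = rb + n * ra"
  have A_0: "coding_range X (A 0) 0"
    by (auto simp: coding_range_def A_def H_Nil)
  have A_linear: "coding_range X (A d) (d * ra)" for d
  proof (induction d)
    case (Suc d)
    have "coding_range X (A (Suc d)) (ra + d * ra)"
      unfolding A_Suc \<phi>_def ra_def
      by (rule coding_range_compose[OF \<rho> Suc[unfolded ra_def]]) (simp add: A_def Hsub)
    then show ?case by simp
  qed (simp add: A_0)
  text \<open>Horner's scheme in base \<open>n\<close>: \<open>a\<^bsup>nq + d\<^esup> = b a\<^bsup>q\<^esup> b\<^bsup>-1\<^esup> a\<^bsup>d\<^esup>\<close>.\<close>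
  have A_Horner: "A (n * q + d) =
      compose X (compose X (H [(Gen_b, True)]) (compose X (A q) (H [(Gen_b, False)]))) (A d)" for q d
    unfolding A_def replicate_add H_append[of "replicate (n * q) _"]
      H_eq[OF BS_conj_power, symmetric] H_append ..
  have A_log: "coding_range X (A i) (C * K)" if "i < n ^ K" for i K
    using that
  proof (induction K arbitrary: i)
    case 0
    then show ?case using A_0 by simp
  next
    case (Suc K)
    \<comment> \<open>\<open>d\<close> is the last digit in base \<open>n\<close>, and
      \<open>q\<close> has one digit fewer than \<open>i\<close>.\<close>
    define q d where "q = i div n" and "d = i mod n"
    have i: "i = n * q + d" and d: "d \<le> n"
      using assms(1) by (simp_all add: q_def d_def less_imp_le)
    have "q < n ^ K"
      using Suc.prems assms(1) by (simp add: q_def div_less_iff_less_mult mult.commute)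
    from Suc.IH[OF this] have q: "coding_range X (A q) (C * K)" .
    have "coding_range X (A i)
        ((\<rho> [(Gen_b, True)] + (C * K + \<rho> [(Gen_b, False)])) + d * ra)"
      unfolding i A_Horner
    proof (intro coding_range_compose q \<rho> A_linear)
      show "compose X (A q) (H [(Gen_b, False)]) ` X \<subseteq> X" "A d ` X \<subseteq> X"
        unfolding A_def H_append[symmetric] by (rule Hsub)+
    qed (rule Hsub)
    moreover have "(\<rho> [(Gen_b, True)] + (C * K + \<rho> [(Gen_b, False)])) + d * ra \<le> C * Suc K"
      using d by (simp add: C_def rb_def)
    ultimately show ?case by (rule coding_range_mono)
  qed
  have "coding_range X (\<phi> ^^ i) (C * K)" if "i < n ^ K" for i K
    using A_log[OF that] A_funpow by (rule coding_range_cong)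
  then have "\<exists>p>0. \<forall>x\<in>X. (\<phi> ^^ p) x = x"
    using zero_entropy_log_range_finite_order[OF assms(2-4) H(2,4) assms(1)]
    unfolding \<phi>_def by blast
  then obtain p where p: "p > 0" "\<And>x. x \<in> X \<Longrightarrow> (\<phi> ^^ p) x = x" by blast
  \<comment> \<open>Agreement on \<open>X\<close> becomes equality of group elements because both
    sides are extensional; injectivity of \<open>h\<close> then yields a^p = 1 in the presented
    group.\<close>
  have "A p = H []"
  proof (rule extensionalityI)
    show "A p \<in> extensional X" "H [] \<in> extensional X"
      using H(1) by (auto simp: A_def Bij_def)
    show "A p x = H [] x" if "x \<in> X" for x
      using that p(2) by (simp add: A_funpow H_Nil)
  qed
  then have "pres_class (BS_rel n) (replicate p (Gen_a, True)) = pres_class (BS_rel n) []"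
    unfolding A_def H_def by (rule inj_onD[OF inj _ carr carr])
  then have "p = 0"
    using assms(1) by (intro BS_generator_infinite_order) (simp_all only: pres_class_eq_iff)
  then show False using p(1) by simp
qed

end
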